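(* Let $A$ be an associative ring satisfying one of the following two conditions. (I) $A$ is unital and contains three pairwise orthogonal full idempotents $e_1,e_2,e_3$ with $e_1+e_2+e_3=1$. (II) $A$ contains three pairwise orthogonal idempotents $e_1,e_2,e_3$ such that $Ae_iA=Ae_4A=A$ for $1\le i\le3$, where $e_4=1-e_1-e_2-e_3$, and $\operatorname{Ann}(A)=(0)$. Then any derivation of the Lie ring $[A,A]$ extends to a derivation of the associative ring $A$.
   Context: Rings are associative and not necessarily unital unless stated. $[A,A]$ is the additive subgroup generated by all commutators $[a,b]=ab-ba$, viewed as a Lie ring. $AeA$ is the additive subgroup generated by all $aeb$, $a,b\in A$; an idempotent $e\in A$ is full if $AeA=A$. In (II) the ring $A$ is not assumed to contain $1$; $e_4$ lies in the unital hull $A+\mathbb{Z}\cdot1$ (which is $A$ itself if $A$ is unital), and $ae_4b=ab-\sum_{i=1}^3ae_ib$. $\operatorname{Ann}(A)=\{a\in A\mid aA=Aa=(0)\}$. A derivation of the Lie ring $[A,A]$ is an additive map $d:[A,A]\to[A,A]$ with $d([x,y])=[d(x),y]+[x,d(y)]$; a derivation of the ring $A$ is an additive map $D:A\to A$ with $D(ab)=D(a)b+aD(b)$; $D$ extends $d$ if $D(x)=d(x)$ for all $x\in[A,A]$. *)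

theory Defs
  imports "HOL.Modules" "HOL-Computational_Algebra.Group_Closure"
begin

text \<open>The ring \<open>A\<close> is a type of class \<^class>\<open>ring\<close>: associative, not necessarily unital.\<close>

definition lie_bracket :: "'a::ring \<Rightarrow> 'a \<Rightarrow> 'a" where
  "lie_bracket a b = a * b - b * a"

definition commutator_subgroup :: "'a::ring set" where
  "commutator_subgroup = group_closure {lie_bracket a b | a b. True}"

lemma lie_bracket_in_commutator_subgroup: "lie_bracket a b \<in> commutator_subgroup"
  unfolding commutator_subgroup_def by (rule group_closure.base) blast

definition two_sided_span :: "'a::ring \<Rightarrow> 'a set" where
  "two_sided_span e = group_closure {a * e * b | a b. True}"

text \<open>\<open>Ae\<^sub>4A\<close> for \<open>e\<^sub>4 = 1 - e\<^sub>1 - e\<^sub>2 - e\<^sub>3\<close>. As \<open>e\<^sub>4\<close> lies in the unital hull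
  and in general not in \<open>A\<close>, the product \<open>ae\<^sub>4b\<close> is expanded to an element of \<open>A\<close>.\<close>

definition two_sided_span_compl :: "'a::ring \<Rightarrow> 'a \<Rightarrow> 'a \<Rightarrow> 'a set" where
  "two_sided_span_compl e1 e2 e3 =
     group_closure {a * b - (a * e1 * b + a * e2 * b + a * e3 * b) | a b. True}"

definition is_identity :: "'a::ring \<Rightarrow> bool" where
  "is_identity u \<longleftrightarrow> (\<forall>a. u * a = a \<and> a * u = a)"

lemma two_sided_span_compl_unital:
  assumes "is_identity u"
  shows "two_sided_span_compl e1 e2 e3 = two_sided_span (u - e1 - e2 - e3)"
  using assms
  by (simp add: two_sided_span_compl_def two_sided_span_def is_identity_def algebra_simps)

definition idempotent_elt :: "'a::ring \<Rightarrow> bool" where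
  "idempotent_elt e \<longleftrightarrow> e * e = e"

definition full_idempotent :: "'a::ring \<Rightarrow> bool" where
  "full_idempotent e \<longleftrightarrow> idempotent_elt e \<and> two_sided_span e = UNIV"

definition orthogonal_elts :: "'a::ring \<Rightarrow> 'a \<Rightarrow> bool" where
  "orthogonal_elts e f \<longleftrightarrow> e * f = 0 \<and> f * e = 0"

definition pairwise_orthogonal3 :: "'a::ring \<Rightarrow> 'a \<Rightarrow> 'a \<Rightarrow> bool" where
  "pairwise_orthogonal3 e1 e2 e3 \<longleftrightarrow>
     orthogonal_elts e1 e2 \<and> orthogonal_elts e1 e3 \<and> orthogonal_elts e2 e3"

definition annihilator :: "'a::ring set" where
  "annihilator = {a. \<forall>b. a * b = 0 \<and> b * a = 0}"

definition condition_I :: "'a::ring itself \<Rightarrow> bool" where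
  "condition_I _ \<longleftrightarrow>
     (\<exists>u e1 e2 e3 :: 'a. is_identity u \<and>
        full_idempotent e1 \<and> full_idempotent e2 \<and> full_idempotent e3 \<and>
        pairwise_orthogonal3 e1 e2 e3 \<and> e1 + e2 + e3 = u)"

definition condition_II :: "'a::ring itself \<Rightarrow> bool" where
  "condition_II _ \<longleftrightarrow>
     (\<exists>e1 e2 e3 :: 'a.
        idempotent_elt e1 \<and> idempotent_elt e2 \<and> idempotent_elt e3 \<and>
        pairwise_orthogonal3 e1 e2 e3 \<and>
        two_sided_span e1 = UNIV \<and> two_sided_span e2 = UNIV \<and> two_sided_span e3 = UNIV \<and>
        two_sided_span_compl e1 e2 e3 = UNIV) \<and>
     (annihilator :: 'a set) = {0}"

text \<open>A map \<open>[A,A] \<rightarrow> [A,A]\<close> is represented by a function on all of \<open>A\<close>; its values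
  outside \<open>[A,A]\<close> are irrelevant.\<close>

definition lie_derivation_commutators :: "('a::ring \<Rightarrow> 'a) \<Rightarrow> bool" where
  "lie_derivation_commutators d \<longleftrightarrow>
     d ` commutator_subgroup \<subseteq> commutator_subgroup \<and>
     (\<forall>x\<in>commutator_subgroup. \<forall>y\<in>commutator_subgroup.
        d (x + y) = d x + d y \<and>
        d (lie_bracket x y) = lie_bracket (d x) y + lie_bracket x (d y))"

definition ring_derivation :: "('a::ring \<Rightarrow> 'a) \<Rightarrow> bool" where
  "ring_derivation D \<longleftrightarrow> Modules.additive D \<and> (\<forall>a b. D (a * b) = D a * b + a * D b)"

end

theory Submission
  imports Defs
begin

text \<open>
Write \<open>A\<^sub>i\<^sub>j = e\<^sub>iAe\<^sub>j\<close> for the Peirce components of \<open>A\<close>, with indices \<open>1, 2, 3\<close> in case (I) and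
\<open>1, 2, 3, 4\<close> in case (II). The corners with \<open>i \<noteq> j\<close> lie in \<open>[A,A]\<close>, because \<open>a = [e\<^sub>i, a] = [a, e\<^sub>j]\<close>
there, and they generate it as a Lie ring, because \<open>A\<^sub>p\<^sub>q = A\<^sub>p\<^sub>rA\<^sub>r\<^sub>q\<close> by fullness. A Lie derivation \<open>d\<close> is thus
determined by its values on these corners, and there the Lie bracket knows the associative
product: \<open>[a, b] = ab\<close> for \<open>a \<in> A\<^sub>i\<^sub>j\<close>, \<open>b \<in> A\<^sub>j\<^sub>k\<close> with \<open>i, j, k\<close> distinct. The obstacle is
that \<open>d\<close> need not be defined at the idempotents \<open>e\<^sub>i\<close> themselves: in general
neither they nor their differences lie in \<open>[A,A]\<close>.

The proof compares Peirce components in the relations that hold between elements of off-diagonal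
corners. Since \<open>a \<in> A\<^sub>i\<^sub>j\<close> commutes with many corners, \<open>d a\<close> has components only in row \<open>i\<close> and in
column \<open>j\<close> (\<open>component_d_off_diagonal\<close>, \<open>component_d_diagonal\<close>). As a function of \<open>a\<close>, the component
in row \<open>p \<noteq> i\<close> is right linear, hence a left multiplication by some \<open>u\<^sub>p\<^sub>i \<in> A\<^sub>p\<^sub>i\<close>, and the same
\<open>u\<^sub>p\<^sub>i\<close> describes the components in the columns (\<open>off_diagonal_part_inner\<close>). With \<open>u = \<Sum> u\<^sub>p\<^sub>i\<close>, the
Lie derivation \<open>d - [u, \<sqdot>]\<close> maps each off-diagonal corner to itself (\<open>inner_up_to_graded\<close>).

For such a graded \<open>d\<close> the product rule holds along paths of three distinct indices. An extension
\<open>D\<close> is forced to satisfy \<open>D(s)a = d(sa) - s d(a)\<close> and \<open>b D(s) = d(bs) - d(b)s\<close> for \<open>s \<in> A\<^sub>i\<^sub>i\<close> and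
\<open>a \<in> A\<^sub>i\<^sub>k\<close>, \<open>b \<in> A\<^sub>k\<^sub>i\<close>. These equations have at most one solution because \<open>Ann(A) = (0)\<close>, and they
have one because \<open>A\<^sub>i\<^sub>i = A\<^sub>i\<^sub>kA\<^sub>k\<^sub>i\<close> (\<open>corner_lift_unique\<close>, \<open>corner_lift_exists\<close>). The pairs
\<open>(s, D(s))\<close> are closed under sums and products, so \<open>D\<close> is a derivation, and
\<open>D + [u, \<sqdot>]\<close> extends the original \<open>d\<close>.
\<close>

section \<open>Peirce decompositions\<close>

text \<open>
The idempotents \<open>e\<^sub>i\<close> enter only through the maps \<open>x \<mapsto> e\<^sub>ix\<close> and \<open>x \<mapsto> xe\<^sub>i\<close>, because
\<open>e\<^sub>4\<close> may lie outside \<open>A\<close>. An index is internal if its two maps come from an element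
of \<open>A\<close>, which then is a local unit for its row and its column.
\<close>
definition internal_multiplier :: "('a::ring \<Rightarrow> 'a) \<Rightarrow> ('a \<Rightarrow> 'a) \<Rightarrow> bool" where
  "internal_multiplier l r \<longleftrightarrow> (\<exists>e. \<forall>x. l x = e * x \<and> r x = x * e)"

text \<open>
\<open>L i\<close> and \<open>R i\<close> are the left and right multiplication by the \<open>i\<close>-th of a complete family of
full orthogonal idempotents. At most one idempotent may be missing from the ring, and none if
there are only three of them; this covers the three idempotents of condition (I) as well as the
four of condition (II). The assumption \<open>faithful\<close> says \<open>Ann(A) = (0)\<close>.
\<close>
locale peirce_system =
  fixes I :: "'i set" and L R :: "'i \<Rightarrow> 'a::ring \<Rightarrow> 'a"
  assumes finite_I: "finite I"
    and card_I: "3 \<le> card I"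
    and L_diff: "L i (x - y) = L i x - L i y"
    and R_diff: "R i (x - y) = R i x - R i y"
    and L_mult: "L i (x * y) = L i x * y"
    and R_mult: "R i (x * y) = x * R i y"
    and balanced: "R i x * y = x * L i y"
    and L_R: "L i (R j x) = R j (L i x)"
    and L_L: "i \<in> I \<Longrightarrow> j \<in> I \<Longrightarrow> L i (L j x) = (if i = j then L i x else 0)"
    and R_R: "i \<in> I \<Longrightarrow> j \<in> I \<Longrightarrow> R i (R j x) = (if i = j then R i x else 0)"
    and sum_L: "(\<Sum>i\<in>I. L i x) = x"
    and sum_R: "(\<Sum>i\<in>I. R i x) = x"
    and full: "i \<in> I \<Longrightarrow> group_closure {R i a * b | a b. True} = UNIV"
    and faithful: "(\<And>b::'a. a * b = 0) \<Longrightarrow> (\<And>b. b * a = 0) \<Longrightarrow> a = 0"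
    and internal_or: "i \<in> I \<Longrightarrow> j \<in> I \<Longrightarrow> i \<noteq> j \<Longrightarrow>
      internal_multiplier (L i) (R i) \<or> internal_multiplier (L j) (R j)"
    and internal_if_card_3: "card I = 3 \<Longrightarrow> i \<in> I \<Longrightarrow> internal_multiplier (L i) (R i)"
begin

abbreviation "internal i \<equiv> internal_multiplier (L i) (R i)"

lemma L_zero [simp]: "L i 0 = 0" using L_diff[of i 0 0] by simp
lemma R_zero [simp]: "R i 0 = 0" using R_diff[of i 0 0] by simp
lemma L_add: "L i (x + y) = L i x + L i y" using L_diff[of i "x + y" y] by simp
lemma R_add: "R i (x + y) = R i x + R i y" using R_diff[of i "x + y" y] by simp

definition corner :: "'i \<Rightarrow> 'i \<Rightarrow> 'a set" where
  "corner p q = {x. L p x = x \<and> R q x = x}"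

definition component :: "'i \<Rightarrow> 'i \<Rightarrow> 'a \<Rightarrow> 'a" where
  "component p q x = L p (R q x)"

lemma component_diff: "component p q (x - y) = component p q x - component p q y"
  by (simp add: component_def L_diff R_diff)
lemma component_add: "component p q (x + y) = component p q x + component p q y"
  by (simp add: component_def L_add R_add)
lemma component_zero [simp]: "component p q 0 = 0" by (simp add: component_def)
lemma component_sum: "component p q (sum f A) = (\<Sum>i\<in>A. component p q (f i))"
  by (induction A rule: infinite_finite_induct) (simp_all add: component_add)

lemma component_in_corner [intro, simp]: "p \<in> I \<Longrightarrow> q \<in> I \<Longrightarrow> component p q x \<in> corner p q"
  by (simp add: corner_def component_def L_L R_R flip: L_R)

lemma component_of_corner: "x \<in> corner r s \<Longrightarrow> p \<in> I \<Longrightarrow> q \<in> I \<Longrightarrow> r \<in> I \<Longrightarrow> s \<in> I \<Longrightarrow>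
    component p q x = (if p = r \<and> q = s then x else 0)"
  unfolding corner_def component_def
  by (auto, (metis (no_types, lifting) L_L R_R L_R L_zero R_zero)+)

lemma component_id: "x \<in> corner p q \<Longrightarrow> component p q x = x"
  by (simp add: corner_def component_def)

lemma corner_zero [simp, intro]: "0 \<in> corner p q" by (simp add: corner_def)
lemma corner_diff [intro]: "x \<in> corner p q \<Longrightarrow> y \<in> corner p q \<Longrightarrow> x - y \<in> corner p q"
  by (simp add: corner_def L_diff R_diff)
lemma corner_add [intro]: "x \<in> corner p q \<Longrightarrow> y \<in> corner p q \<Longrightarrow> x + y \<in> corner p q"
  by (simp add: corner_def L_add R_add)
lemma corner_minus [intro]: "x \<in> corner p q \<Longrightarrow> - x \<in> corner p q"
  using corner_diff[of 0 p q x] by simp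
lemma corner_mult [intro]: "x \<in> corner p q \<Longrightarrow> y \<in> corner q r \<Longrightarrow> x * y \<in> corner p r"
  by (simp add: corner_def L_mult R_mult)

lemma corner_mult_eq_0: "x \<in> corner p q \<Longrightarrow> y \<in> corner r s \<Longrightarrow> q \<in> I \<Longrightarrow> r \<in> I \<Longrightarrow> q \<noteq> r \<Longrightarrow> x * y = 0"
  unfolding corner_def by (metis (mono_tags, lifting) L_L balanced mem_Collect_eq mult_zero_right)

lemma sum_component: "(\<Sum>p\<in>I. \<Sum>q\<in>I. component p q x) = x"
proof -
  have "(\<Sum>q\<in>I. component p q x) = L p x" for p
    unfolding component_def L_R by (rule sum_R)
  then show ?thesis by (simp add: sum_L)
qed

text \<open>
This and the next lemma turn an identity between brackets with elements of single corners into
one identity for each pair \<open>(p, q)\<close>, which the simplifier evaluates as soon as it knows which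
indices are equal.
\<close>
lemma component_mult_corner: "b \<in> corner k l \<Longrightarrow> p \<in> I \<Longrightarrow> q \<in> I \<Longrightarrow> k \<in> I \<Longrightarrow> l \<in> I \<Longrightarrow>
    component p q (x * b) = (if q = l then component p k x * b else 0)"
proof -
  assume b: "b \<in> corner k l" and i: "p \<in> I" "q \<in> I" "k \<in> I" "l \<in> I"
  have "component p q (x * b) = L p x * R q b" by (simp add: component_def L_mult R_mult)
  moreover have "R q b = (if q = l then b else 0)"
    using b i R_R[of q l b] by (auto simp: corner_def)
  moreover have "component p k x * b = L p x * b"
    using b balanced[of k "L p x" b] by (simp add: component_def corner_def L_R)
  ultimately show ?thesis by simp
qed

lemma component_corner_mult: "b \<in> corner k l \<Longrightarrow> p \<in> I \<Longrightarrow> q \<in> I \<Longrightarrow> k \<in> I \<Longrightarrow> l \<in> I \<Longrightarrow>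
    component p q (b * x) = (if p = k then b * component l q x else 0)"
proof -
  assume b: "b \<in> corner k l" and i: "p \<in> I" "q \<in> I" "k \<in> I" "l \<in> I"
  have "component p q (b * x) = L p b * R q x" by (simp add: component_def L_mult R_mult)
  moreover have "L p b = (if p = k then b else 0)"
    using b i L_L[of p k b] by (auto simp: corner_def)
  moreover have "b * component l q x = b * R q x"
    using b balanced[of l b "R q x"] by (simp add: component_def corner_def)
  ultimately show ?thesis by simp
qed

lemma component_assemble:
  assumes "\<And>p q. p \<in> I \<Longrightarrow> q \<in> I \<Longrightarrow> f p q \<in> corner p q" "i \<in> I" "j \<in> I"
  shows "component i j (\<Sum>p\<in>I. \<Sum>q\<in>I. f p q) = f i j"
proof -
  have "component i j (\<Sum>p\<in>I. \<Sum>q\<in>I. f p q) =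
      (\<Sum>p\<in>I. \<Sum>q\<in>I. if p = i then (if q = j then f p q else 0) else 0)"
    unfolding component_sum by (intro sum.cong refl) (use assms(2,3) component_of_corner[OF assms(1)] in auto)
  also have "\<dots> = (\<Sum>p\<in>I. if p = i then (\<Sum>q\<in>I. if q = j then f p q else 0) else 0)"
    by (intro sum.cong) auto
  also have "\<dots> = f i j" using assms(2,3) finite_I by simp
  finally show ?thesis .
qed

lemma component_mult: "i \<in> I \<Longrightarrow> l \<in> I \<Longrightarrow> component i l (x * y) = (\<Sum>j\<in>I. component i j x * component j l y)"
proof -
  have "component i l (x * y) = L i x * R l y" by (simp add: component_def L_mult R_mult)
  also have "\<dots> = (\<Sum>j\<in>I. R j (L i x)) * R l y" by (simp add: sum_R)
  also have "\<dots> = (\<Sum>j\<in>I. R j (L i x) * R l y)" by (rule sum_distrib_right)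
  also have "\<dots> = (\<Sum>j\<in>I. component i j x * component j l y)"
  proof (rule sum.cong)
    fix j assume "j \<in> I"
    then have "R j (L i x) * R l y = R j (R j (L i x)) * R l y" by (simp add: R_R)
    then show "R j (L i x) * R l y = component i j x * component j l y"
      by (simp only: balanced component_def L_R)
  qed simp
  finally show ?thesis .
qed

lemma eq_by_component:
  assumes "\<And>p q. p \<in> I \<Longrightarrow> q \<in> I \<Longrightarrow> component p q x = component p q y"
  shows "x = y"
  using assms sum_component[of x] sum_component[of y] by (metis (no_types, lifting) sum.cong)

text \<open>
Fullness of \<open>e\<^sub>r\<close> reduces a test against all of \<open>A\<close> to a test against the single corner
\<open>A\<^sub>q\<^sub>r\<close>: \<open>xA = xAe\<^sub>rA = xe\<^sub>qAe\<^sub>rA\<close>.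
\<close>
lemma mult_right_eq_0:
  assumes "x \<in> corner p q" "r \<in> I" "\<And>y. y \<in> corner q r \<Longrightarrow> x * y = 0" "q \<in> I"
  shows "x * z = 0"
proof -
  have "z \<in> group_closure {R r a * b | a b. True}" using full[OF \<open>r \<in> I\<close>] by simp
  then show ?thesis
  proof induction
    case (base s)
    have "x * (R r a * b) = 0" for a b
    proof -
      have "x * (R r a * b) = x * component q r a * b"
        using assms(1) balanced[of q x "R r a"] by (simp add: corner_def component_def flip: mult.assoc)
      then show ?thesis using assms by simp
    qed
    then show ?case using base by auto
  qed (simp add: right_diff_distrib)
qed

lemma mult_left_eq_0:
  assumes "x \<in> corner p q" "r \<in> I" "\<And>y. y \<in> corner r p \<Longrightarrow> y * x = 0" "p \<in> I"
  shows "z * x = 0"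
proof -
  have "z \<in> group_closure {R r a * b | a b. True}" using full[OF \<open>r \<in> I\<close>] by simp
  then show ?thesis
  proof induction
    case (base s)
    have "(R r a * b) * x = 0" for a b
    proof -
      have "(R r a * b) * x = a * (component r p b * x)"
        using assms(1) balanced[of r a b] balanced[of p "L r b" x]
        by (simp add: corner_def component_def mult.assoc L_R)
      then show ?thesis using assms by simp
    qed
    then show ?case using base by auto
  qed (simp add: left_diff_distrib)
qed

text \<open>
There are two ways to conclude that an element of a corner is zero. The first tests it on both
sides and ends with \<open>Ann(A) = (0)\<close>. A test on one side suffices if the idempotent on that side
is an element of \<open>A\<close>; without this, one-sided annihilators can be non-zero.
\<close>
lemma corner_eq_0:
  assumes "x \<in> corner p q" "p \<in> I" "q \<in> I" "r \<in> I" "s \<in> I"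
    "\<And>y. y \<in> corner q r \<Longrightarrow> x * y = 0" "\<And>y. y \<in> corner s p \<Longrightarrow> y * x = 0"
  shows "x = 0"
proof (rule faithful)
  show "x * b = 0" for b using mult_right_eq_0[OF assms(1,4) _ assms(3)] assms(6) by blast
  show "b * x = 0" for b using mult_left_eq_0[OF assms(1,5) _ assms(2)] assms(7) by blast
qed

lemma corner_eq_0_right:
  assumes "x \<in> corner p q" "internal q" "q \<in> I" "r \<in> I" "\<And>y. y \<in> corner q r \<Longrightarrow> x * y = 0"
  shows "x = 0"
  using mult_right_eq_0[OF assms(1,4,5,3)] assms(1,2)
  unfolding corner_def internal_multiplier_def by force

lemma corner_eq_0_left:
  assumes "x \<in> corner p q" "internal p" "p \<in> I" "r \<in> I" "\<And>y. y \<in> corner r p \<Longrightarrow> y * x = 0"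
  shows "x = 0"
  using mult_left_eq_0[OF assms(1,4,5,3)] assms(1,2)
  unfolding corner_def internal_multiplier_def by force

lemma internal_unit:
  assumes "internal i" "i \<in> I"
  obtains e where "e \<in> corner i i" "\<And>p x. x \<in> corner p i \<Longrightarrow> x * e = x" "\<And>q x. x \<in> corner i q \<Longrightarrow> e * x = x"
proof -
  obtain e where e: "\<forall>x. L i x = e * x \<and> R i x = x * e"
    using assms(1) by (auto simp: internal_multiplier_def)
  show ?thesis
  proof
    show "e * e \<in> corner i i"
      using L_L[of i i e] R_R[of i i e] e assms by (simp add: corner_def mult.assoc)
    show "x * (e * e) = x" if "x \<in> corner p i" for p x
      using that e by (simp add: corner_def flip: mult.assoc)
    show "e * e * x = x" if "x \<in> corner i q" for q x
      using that e by (simp add: corner_def mult.assoc)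
  qed
qed

text \<open>
\<open>A\<^sub>p\<^sub>q = A\<^sub>p\<^sub>rA\<^sub>r\<^sub>q\<close> for each \<open>r\<close>, because \<open>A = Ae\<^sub>rA\<close>. As an induction rule it replaces the
choice of a representation by a finite sum of products: two additive maps agree on a corner, or
a multiplier exists for each of its elements, as soon as this is so for products.
\<close>
lemma corner_induct [consumes 1, case_names index zero diff mult]:
  assumes z: "z \<in> corner p q" and i: "p \<in> I \<and> q \<in> I \<and> r \<in> I"
    and zero: "Q 0"
    and diff: "\<And>x y. x \<in> corner p q \<Longrightarrow> y \<in> corner p q \<Longrightarrow> Q x \<Longrightarrow> Q y \<Longrightarrow> Q (x - y)"
    and mult: "\<And>x y. x \<in> corner p r \<Longrightarrow> y \<in> corner r q \<Longrightarrow> Q (x * y)"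
  shows "Q z"
proof -
  have "z \<in> group_closure {R r a * b | a b. True}" using full i by blast
  then have "Q (component p q z)"
  proof induction
    case (base s)
    have "Q (component p q (R r a * b))" for a b
    proof -
      have "R r (R r a) = R r a" using R_R i by auto
      then have "component p q (R r a * b) = component p r a * component r q b"
        using balanced[of r "R r a" b] balanced[of r "L p (R r a)" "R q b"]
        by (simp add: component_def L_mult R_mult L_R)
      then show ?thesis using mult i by auto
    qed
    then show ?case using base zero by auto
  next
    case (diff s t)
    then show ?case using assms(4) i by (simp add: component_diff)
  qed
  then show ?thesis using z by (simp add: component_id)
qed

lemma exists_other_index:
  assumes "card S < card I" "finite S"
  obtains r where "r \<in> I" "r \<notin> S"
  using assms by (meson card_mono linorder_not_le subsetI)

text \<open>
The factorizations below go through an auxiliary index that avoids two given ones, which is why at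
least three idempotents are required; a fourth one allows a third index to be avoided.
\<close>
lemma index_other_than_2: obtains r where "r \<in> I" "r \<noteq> p" "r \<noteq> q"
proof -
  have "card {p, q} \<le> 2" by (simp add: card_insert_if)
  then have "card {p, q} < card I" using card_I by linarith
  then show ?thesis using exists_other_index[of "{p, q}"] that by auto
qed

lemma index_other_than_3:
  assumes "card I \<noteq> 3"
  obtains r where "r \<in> I" "r \<noteq> p" "r \<noteq> q" "r \<noteq> s"
proof -
  have "card {p, q, s} \<le> 3" by (simp add: card_insert_if)
  then have "card {p, q, s} < card I" using card_I assms by linarith
  then show ?thesis using exists_other_index[of "{p, q, s}"] that by auto
qed

lemma index_cases_if_card_3:
  assumes "card I = 3" "{i, j, k} \<subseteq> I" "i \<noteq> j" "i \<noteq> k" "j \<noteq> k" "p \<in> I"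
  shows "p = i \<or> p = j \<or> p = k"
proof -
  have "card {i, j, k} = card I" using assms by simp
  then have "{i, j, k} = I" using assms finite_I card_subset_eq by blast
  then show ?thesis using assms by auto
qed

text \<open>
\<open>x = [e\<^sub>i, x] = [x, e\<^sub>j]\<close>, and one of the two idempotents is an element of \<open>A\<close>.
\<close>
lemma off_diagonal_in_commutator_subgroup:
  assumes "x \<in> corner i j" "i \<in> I" "j \<in> I" "i \<noteq> j"
  shows "x \<in> commutator_subgroup"
proof -
  have Li: "L j x = 0" "R i x = 0" "L i x = x" "R j x = x"
    using assms L_L[of j i x] R_R[of i j x] by (auto simp: corner_def)
  from internal_or[OF assms(2-4)] show ?thesis
  proof
    assume "internal i"
    then obtain e where "\<forall>x. L i x = e * x \<and> R i x = x * e" by (auto simp: internal_multiplier_def)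
    then have "x = lie_bracket e x" using Li by (simp add: lie_bracket_def)
    then show ?thesis using lie_bracket_in_commutator_subgroup by metis
  next
    assume "internal j"
    then obtain e where "\<forall>x. L j x = e * x \<and> R j x = x * e" by (auto simp: internal_multiplier_def)
    then have "x = lie_bracket x e" using Li by (simp add: lie_bracket_def)
    then show ?thesis using lie_bracket_in_commutator_subgroup by metis
  qed
qed

text \<open>
The off-diagonal corners generate the Lie ring \<open>[A,A]\<close>; more precisely, \<open>[A,A]\<close> is the sum of the
corners \<open>A\<^sub>i\<^sub>j\<close> and of the groups \<open>[A\<^sub>i\<^sub>j, A\<^sub>j\<^sub>i]\<close> with \<open>i \<noteq> j\<close>. The only case that is not immediate
is \<open>[A\<^sub>p\<^sub>p, A\<^sub>p\<^sub>p]\<close>, where \<open>A\<^sub>p\<^sub>p = A\<^sub>p\<^sub>rA\<^sub>r\<^sub>p\<close> and \<open>[xy,b] = [x,yb] + [y,bx]\<close>.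
\<close>
lemma commutator_subgroup_induct [consumes 1, case_names zero diff corner bracket]:
  assumes z: "z \<in> commutator_subgroup"
    and zero: "Q 0"
    and diff: "\<And>x y. x \<in> commutator_subgroup \<Longrightarrow> y \<in> commutator_subgroup \<Longrightarrow> Q x \<Longrightarrow> Q y \<Longrightarrow> Q (x - y)"
    and corner: "\<And>i j x. i \<in> I \<Longrightarrow> j \<in> I \<Longrightarrow> i \<noteq> j \<Longrightarrow> x \<in> corner i j \<Longrightarrow> Q x"
    and bracket: "\<And>i j x y. i \<in> I \<Longrightarrow> j \<in> I \<Longrightarrow> i \<noteq> j \<Longrightarrow> x \<in> corner i j \<Longrightarrow> y \<in> corner j i \<Longrightarrow>
      Q (lie_bracket x y)"
  shows "Q z"
proof -
  define G where "G = {x \<in> commutator_subgroup. Q x}"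
  have G0: "0 \<in> G" using zero by (simp add: G_def commutator_subgroup_def)
  have Gd: "x - y \<in> G" if "x \<in> G" "y \<in> G" for x y
    using that diff by (auto simp: G_def commutator_subgroup_def intro: group_closure.diff)
  have Ga: "x + y \<in> G" if "x \<in> G" "y \<in> G" for x y
    using Gd[OF that(1) Gd[OF G0 that(2)]] by simp
  have Gs: "sum f A \<in> G" if "\<And>i. i \<in> A \<Longrightarrow> f i \<in> G" for f :: "'i \<Rightarrow> 'a" and A
    using that by (induction A rule: infinite_finite_induct) (auto simp: G0 Ga)
  have Gc: "x \<in> G" if "i \<in> I" "j \<in> I" "i \<noteq> j" "x \<in> corner i j" for i j x
    using that corner off_diagonal_in_commutator_subgroup by (auto simp: G_def)
  have Gb: "lie_bracket x y \<in> G" if "i \<in> I" "j \<in> I" "i \<noteq> j" "x \<in> corner i j" "y \<in> corner j i" for i j x y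
    using that bracket lie_bracket_in_commutator_subgroup by (auto simp: G_def)
  have diagonal: "lie_bracket a b \<in> G" if "p \<in> I" "a \<in> corner p p" "b \<in> corner p p" for p a b
  proof -
    obtain r where r: "r \<in> I" "r \<noteq> p" using index_other_than_2 by metis
    from that(2) show ?thesis
    proof (induction a rule: corner_induct[where r = r])
      case (diff x y)
      then show ?case using Gd[of "lie_bracket x b" "lie_bracket y b"]
        by (simp add: lie_bracket_def algebra_simps)
    next
      case (mult x y)
      have "lie_bracket (x * y) b = lie_bracket x (y * b) + lie_bracket y (b * x)"
        by (simp add: lie_bracket_def algebra_simps)
      then show ?case
        using Ga Gb[of p r x "y * b"] Gb[of r p y "b * x"] mult r that by (metis corner_mult)
    qed (use that r G0 in \<open>auto simp: lie_bracket_def\<close>)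
  qed
  have corners: "lie_bracket a b \<in> G"
    if i: "p \<in> I" "q \<in> I" "r \<in> I" "s \<in> I" and a: "a \<in> corner p q" and b: "b \<in> corner r s" for p q r s a b
  proof (cases "q = r \<and> p = s")
    case True
    then show ?thesis using that Gb diagonal by blast
  next
    case False
    have "a * b \<in> G" if "p \<noteq> s \<or> q \<noteq> r"
      using that i a b Gc corner_mult_eq_0[OF a b] G0 corner_mult by (metis corner_mult)
    moreover have "b * a \<in> G" if "p \<noteq> s \<or> q \<noteq> r"
      using that i a b Gc corner_mult_eq_0[OF b a] G0 corner_mult by (metis corner_mult)
    ultimately show ?thesis using False Gd unfolding lie_bracket_def by blast
  qed
  have all: "lie_bracket a b \<in> G" for a b
  proof -
    have "lie_bracket a b =
      (\<Sum>p\<in>I. \<Sum>q\<in>I. \<Sum>r\<in>I. \<Sum>s\<in>I. lie_bracket (component p q a) (component r s b))"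
      unfolding lie_bracket_def sum_subtractf
      by (simp add: sum_component flip: sum_distrib_left sum_distrib_right)
    also have "\<dots> \<in> G" by (intro Gs) (rule corners[OF _ _ _ _ component_in_corner component_in_corner])
    finally show ?thesis .
  qed
  have "z \<in> G"
    using z unfolding commutator_subgroup_def
    by (induction rule: group_closure.induct) (use G0 all Gd in auto)
  then show ?thesis by (simp add: G_def)
qed

end

section \<open>Components of a Lie derivation\<close>

locale peirce_lie_derivation = peirce_system I L R
  for I :: "'i set" and L R :: "'i \<Rightarrow> 'a::ring \<Rightarrow> 'a" +
  fixes d :: "'a \<Rightarrow> 'a"
  assumes lie: "lie_derivation_commutators d"
begin

lemma d_add: "x \<in> commutator_subgroup \<Longrightarrow> y \<in> commutator_subgroup \<Longrightarrow> d (x + y) = d x + d y"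
  using lie by (simp add: lie_derivation_commutators_def)

lemma d_diff:
  assumes "x \<in> commutator_subgroup" "y \<in> commutator_subgroup"
  shows "d (x - y) = d x - d y"
proof -
  have "x - y \<in> commutator_subgroup"
    using assms by (simp add: commutator_subgroup_def group_closure.diff)
  from d_add[OF this assms(2)] show ?thesis by simp
qed

lemma d_zero [simp]: "d 0 = 0"
  using d_diff[of 0 0] by (simp add: commutator_subgroup_def)

lemma d_corner_diff:
  "i \<in> I \<Longrightarrow> j \<in> I \<Longrightarrow> i \<noteq> j \<Longrightarrow> x \<in> corner i j \<Longrightarrow> y \<in> corner i j \<Longrightarrow> d (x - y) = d x - d y"
  by (intro d_diff off_diagonal_in_commutator_subgroup)

lemma d_bracket:
  "x \<in> commutator_subgroup \<Longrightarrow> y \<in> commutator_subgroup \<Longrightarrow>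
    d (x * y - y * x) = (d x * y - y * d x) + (x * d y - d y * x)"
  using lie by (simp add: lie_derivation_commutators_def lie_bracket_def)

text \<open>
The components of \<open>d a\<close> are found from two kinds of relations between elements of off-diagonal
corners: \<open>[a, b] = ab\<close> if the indices form a path \<open>i, j, k\<close> of distinct indices, and \<open>[a, b] = 0\<close> if
the corners cannot be multiplied in either order. Each is recorded in all components at once.
\<close>
lemma component_d_product:
  assumes "a \<in> corner i j" "b \<in> corner j k" "i \<in> I" "j \<in> I" "k \<in> I" "i \<noteq> j" "j \<noteq> k" "i \<noteq> k"
    "p \<in> I" "q \<in> I"
  shows "component p q (d (a * b)) =
    ((if q = k then component p j (d a) * b else 0) - (if p = j then b * component k q (d a) else 0)) +
    ((if p = i then a * component j q (d b) else 0) - (if q = j then component p i (d b) * a else 0))"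
proof -
  have "b * a = 0" using corner_mult_eq_0[OF assms(2,1)] assms by auto
  then have "d (a * b) = (d a * b - b * d a) + (a * d b - d b * a)"
    using d_bracket[of a b] off_diagonal_in_commutator_subgroup assms by (metis diff_zero)
  then show ?thesis
    using assms by (simp add: component_add component_diff component_mult_corner component_corner_mult)
qed

lemma component_d_commuting:
  assumes "a \<in> corner i j" "b \<in> corner k l" "i \<in> I" "j \<in> I" "k \<in> I" "l \<in> I" "i \<noteq> j" "k \<noteq> l"
    "j \<noteq> k" "i \<noteq> l" "p \<in> I" "q \<in> I"
  shows "(if q = l then component p k (d a) * b else 0) - (if p = k then b * component l q (d a) else 0) =
    (if q = j then component p i (d b) * a else 0) - (if p = i then a * component j q (d b) else 0)"
proof -
  have "a * b = 0" "b * a = 0"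
    using corner_mult_eq_0[OF assms(1,2)] corner_mult_eq_0[OF assms(2,1)] assms by auto
  then have "(d a * b - b * d a) + (a * d b - d b * a) = 0"
    using d_bracket[of a b] off_diagonal_in_commutator_subgroup assms by simp
  then have "d a * b - b * d a = d b * a - a * d b"
    by (simp add: algebra_simps)
  then have "component p q (d a * b - b * d a) = component p q (d b * a - a * d b)"
    by simp
  then show ?thesis
    using assms by (simp add: component_diff component_mult_corner component_corner_mult)
qed

section \<open>Vanishing components\<close>

text \<open>
An element of \<open>A\<^sub>r\<^sub>p\<close> commutes with \<open>a\<close>, and in the component \<open>(r, q)\<close> of the derived relation all
terms but one vanish. The mirror image uses an element of \<open>A\<^sub>q\<^sub>r\<close>.
\<close>
lemma component_d_annihilated_left:
  assumes "a \<in> corner i j" "i \<in> I" "j \<in> I" "i \<noteq> j" "p \<in> I" "q \<in> I"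
    and "p \<noteq> i" "q \<noteq> j" "p \<noteq> q" "r \<in> I" "r \<noteq> i" "r \<noteq> j" "r \<noteq> p" "y \<in> corner r p"
  shows "y * component p q (d a) = 0"
  using component_d_commuting[of a i j y r p r q] assms by (simp split: if_splits)

lemma component_d_annihilated_right:
  assumes "a \<in> corner i j" "i \<in> I" "j \<in> I" "i \<noteq> j" "p \<in> I" "q \<in> I"
    and "p \<noteq> i" "q \<noteq> j" "p \<noteq> q" "r \<in> I" "r \<noteq> i" "r \<noteq> j" "r \<noteq> q" "y \<in> corner q r"
  shows "component p q (d a) * y = 0"
  using component_d_commuting[of a i j y q r p r] assms by (simp split: if_splits)

text \<open>
\<open>d a\<close> has no component outside row \<open>i\<close>, column \<open>j\<close> and the diagonal, as is the case for
\<open>[u, a]\<close>. With four indices the component is annihilated from both sides. With three indices an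
auxiliary index may exist for one side only, and this suffices because all idempotents then
lie in \<open>A\<close>.
\<close>
lemma component_d_off_diagonal:
  assumes a: "a \<in> corner i j" "i \<in> I" "j \<in> I" "i \<noteq> j" "p \<in> I" "q \<in> I"
    and pq: "p \<noteq> i" "q \<noteq> j" "p \<noteq> q"
  shows "component p q (d a) = 0"
proof (cases "card I = 3")
  case False
  obtain r where r: "r \<in> I" "r \<noteq> i" "r \<noteq> j" "r \<noteq> p"
    by (rule index_other_than_3[OF False, of i j p])
  obtain s where s: "s \<in> I" "s \<noteq> i" "s \<noteq> j" "s \<noteq> q"
    by (rule index_other_than_3[OF False, of i j q])
  show ?thesis
    by (rule corner_eq_0[of _ p q s r])
      (use component_d_annihilated_left[OF a pq r] component_d_annihilated_right[OF a pq s] a r s in auto)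
next
  case True
  obtain r where r: "r \<in> I" "r \<noteq> i" "r \<noteq> j" using index_other_than_2 by metis
  have "p = j \<or> q = i"
    using index_cases_if_card_3[OF True, of i j r] a r pq by (metis bot.extremum insert_subset)
  then show ?thesis
  proof
    assume p: "p = j"
    show ?thesis
      by (rule corner_eq_0_left[of _ p q r])
        (use component_d_annihilated_left[OF a pq r] p r a internal_if_card_3[OF True] in auto)
  next
    assume q: "q = i"
    show ?thesis
      by (rule corner_eq_0_right[of _ p q r])
        (use component_d_annihilated_right[OF a pq r] q r a internal_if_card_3[OF True] in auto)
  qed
qed

text \<open>
The diagonal components of \<open>d a\<close> at \<open>k \<noteq> i, j\<close> must vanish as well. If a fourth index \<open>r\<close> exists,
this is read off from \<open>A\<^sub>i\<^sub>j = A\<^sub>i\<^sub>rA\<^sub>r\<^sub>j\<close>. With three indices only the factorization through \<open>k\<close> itself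
is left, and the argument is longer. Let \<open>g(x)\<close> be the component \<open>(k, k)\<close> of \<open>d x\<close>, for
\<open>x \<in> A\<^sub>i\<^sub>j\<close>. Commuting pairs give \<open>g(ac)b = -g(ab)c\<close> for \<open>a \<in> A\<^sub>i\<^sub>k\<close>, \<open>b, c \<in> A\<^sub>k\<^sub>j\<close>, and
its mirror image, so that \<open>g(asb) = g(ab)s = sg(ab)\<close> for \<open>s \<in> A\<^sub>k\<^sub>k\<close>. These
identities alone do not force \<open>g = 0\<close> when \<open>2A = 0\<close>. The missing information comes from
\<open>A\<^sub>i\<^sub>k = A\<^sub>i\<^sub>jA\<^sub>j\<^sub>k\<close>, which relates \<open>g\<close> to the component \<open>(j, k)\<close> of \<open>d\<close> on \<open>A\<^sub>i\<^sub>k\<close>.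
\<close>
context
  fixes i j k :: 'i
  assumes I3: "card I = 3" and ijk: "i \<in> I" "j \<in> I" "k \<in> I" "i \<noteq> j" "i \<noteq> k" "j \<noteq> k"
begin

lemma component_d_jj: "a \<in> corner i k \<Longrightarrow> c \<in> corner k j \<Longrightarrow> component j j (d (a * c)) = component j k (d a) * c"
  using component_d_product[of a i k c j j j] ijk by auto

lemma component_d_ii: "a \<in> corner i k \<Longrightarrow> c \<in> corner k j \<Longrightarrow> component i i (d (a * c)) = a * component k i (d c)"
  using component_d_product[of a i k c j i i] ijk by auto

text \<open>
\<open>g(ac)b\<close> can be computed from \<open>[ac, b] = 0\<close>. The result is \<open>-g(ab)c\<close>, where \<open>g(ab)\<close> is computed from
\<open>ab = [a, b]\<close>.
\<close>
lemma defect_swap_right: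
  assumes "a \<in> corner i k" "b \<in> corner k j" "c \<in> corner k j"
  shows "component k k (d (a * c)) * b = - (component k k (d (a * b)) * c)"
proof -
  have *: "component k k (d (a * c)) * b = b * component j k (d a) * c + component k i (d b) * a * c"
    if "b \<in> corner k j" "c \<in> corner k j" for b c
  proof -
    have "a * c \<in> corner i j" using that assms by auto
    then show ?thesis
      using component_d_commuting[of "a * c" i j b k j k j] that component_d_jj[OF assms(1) that(2)] ijk
      by (simp add: algebra_simps)
  qed
  have "component k k (d (a * b)) = - (b * component j k (d a)) - component k i (d b) * a"
    using component_d_product[of a i k b j k k] assms ijk by auto
  then show ?thesis using *[OF assms(2,3)]
    by (simp only: left_diff_distrib minus_mult_left[symmetric] minus_diff_eq mult.assoc) (simp add: algebra_simps)
qed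

lemma defect_swap_left:
  assumes "a \<in> corner i k" "b \<in> corner i k" "c \<in> corner k j"
  shows "b * component k k (d (a * c)) = - (a * component k k (d (b * c)))"
proof -
  have *: "b * component k k (d (a * c)) = a * component k i (d c) * b + a * c * component j k (d b)"
  proof -
    have "a * c \<in> corner i j" using assms by auto
    then show ?thesis
      using component_d_commuting[of "a * c" i j b i k i k] assms component_d_ii[OF assms(1,3)] ijk
      by (simp add: algebra_simps)
  qed
  have "component k k (d (b * c)) = - (c * component j k (d b)) - component k i (d c) * b"
    using component_d_product[of b i k c j k k] assms ijk by auto
  then show ?thesis using * by (simp add: right_diff_distrib mult.assoc)
qed

text \<open>
The sign rule is applied twice, to \<open>(as)b\<close> and to \<open>a(sc)\<close>: both \<open>g(asb)c\<close> and \<open>g(ab)sc\<close> are equal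
to \<open>-g(asc)b\<close>.
\<close>
lemma defect_linear_right:
  assumes "a \<in> corner i k" "s \<in> corner k k" "b \<in> corner k j"
  shows "component k k (d (a * s * b)) = component k k (d (a * b)) * s"
proof -
  have "(component k k (d (a * s * b)) - component k k (d (a * b)) * s) * c = 0" if c: "c \<in> corner k j" for c
  proof -
    have "component k k (d (a * s * b)) * c = - (component k k (d (a * s * c)) * b)"
      using defect_swap_right[of "a * s" c b] assms c by auto
    also have "\<dots> = component k k (d (a * b)) * (s * c)"
      using defect_swap_right[OF assms(1,3) corner_mult[OF assms(2) c]]
        defect_swap_right[OF assms(1) corner_mult[OF assms(2) c] assms(3)] by (simp add: mult.assoc)
    finally show ?thesis by (simp add: algebra_simps)
  qed
  moreover have "component k k (d (a * s * b)) - component k k (d (a * b)) * s \<in> corner k k"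
    using assms ijk by (intro corner_diff corner_mult) auto
  ultimately have "component k k (d (a * s * b)) - component k k (d (a * b)) * s = 0"
    using corner_eq_0_right[of _ k k j] ijk internal_if_card_3[OF I3] by blast
  then show ?thesis by simp
qed

lemma defect_linear_left:
  assumes "a \<in> corner i k" "s \<in> corner k k" "b \<in> corner k j"
  shows "component k k (d (a * s * b)) = s * component k k (d (a * b))"
proof -
  have "c * (component k k (d (a * s * b)) - s * component k k (d (a * b))) = 0" if c: "c \<in> corner i k" for c
  proof -
    have "c * component k k (d (a * s * b)) = - (a * component k k (d (c * s * b)))"
      using defect_swap_left[of a c "s * b"] assms c by (auto simp: mult.assoc)
    also have "\<dots> = c * s * component k k (d (a * b))"
      using defect_swap_left[OF assms(1) corner_mult[OF c assms(2)] assms(3)] by simp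
    finally show ?thesis by (simp add: algebra_simps)
  qed
  moreover have "component k k (d (a * s * b)) - s * component k k (d (a * b)) \<in> corner k k"
    using assms ijk by (intro corner_diff corner_mult) auto
  ultimately have "component k k (d (a * s * b)) - s * component k k (d (a * b)) = 0"
    using corner_eq_0_left[of _ k k i] ijk internal_if_card_3[OF I3] by blast
  then show ?thesis by simp
qed

text \<open>
Let \<open>f(x)\<close> be the component \<open>(j, k)\<close> of \<open>d x\<close> for \<open>x \<in> A\<^sub>i\<^sub>k\<close>. From \<open>axy = [ax, y]\<close> follows
\<open>f(axy) = f(a)xy - yg(ax)\<close>, and \<open>tyg(ax) = g(ax)ty = -g(at)xy\<close>. Hence
\<open>t(f(a)w - f(aw)) = -g(at)w\<close> for all \<open>w \<in> A\<^sub>k\<^sub>k = A\<^sub>k\<^sub>jA\<^sub>j\<^sub>k\<close>; the left side vanishes at \<open>w = e\<^sub>k\<close>.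
\<close>
lemma defect_zero_on_products:
  assumes "a \<in> corner i k" "t \<in> corner k j"
  shows "component k k (d (a * t)) = 0"
proof -
  let ?f = "\<lambda>w. component j k (d w)" and ?g = "\<lambda>w. component k k (d w)"
  have *: "t * (?f a * w - ?f (a * w)) = - (?g (a * t) * w)" if "w \<in> corner k k" for w
    using that
  proof (induction w rule: corner_induct[where r = j])
    case (diff x y)
    have "d (a * (x - y)) = d (a * x) - d (a * y)"
      using d_corner_diff[of i k "a * x" "a * y"] diff assms ijk by (auto simp: right_diff_distrib)
    then have "t * (?f a * (x - y) - ?f (a * (x - y))) =
        t * (?f a * x - ?f (a * x)) - t * (?f a * y - ?f (a * y))"
      by (simp add: component_diff) (simp add: algebra_simps)
    then show ?case unfolding diff(3,4) by (simp add: right_diff_distrib)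
  next
    case (mult x y)
    have "a * x \<in> corner i j" using mult assms by auto
    then have "?f (a * x * y) = ?f a * x * y - y * ?g (a * x)"
      using component_d_product[of "a * x" i j y k j k] component_d_jj[OF assms(1) mult(1)] mult ijk by auto
    then have "?f a * (x * y) - ?f (a * (x * y)) = y * ?g (a * x)"
      by (simp add: mult.assoc)
    then have "t * (?f a * (x * y) - ?f (a * (x * y))) = t * y * ?g (a * x)"
      by (simp only: mult.assoc)
    \<comment> \<open>values of \<open>g\<close> commute with \<open>ty \<in> A\<^sub>k\<^sub>k\<close>\<close>
    also have "\<dots> = ?g (a * x) * (t * y)"
      using defect_linear_left[OF assms(1) corner_mult[OF assms(2) mult(2)] mult(1)]
        defect_linear_right[OF assms(1) corner_mult[OF assms(2) mult(2)] mult(1)] by simp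
    also have "\<dots> = - (?g (a * t) * (x * y))"
      using defect_swap_right[OF assms mult(1)] by (simp flip: mult.assoc)
    finally show ?case .
  qed (use ijk in auto)
  obtain e where e: "e \<in> corner k k" "\<And>p x. x \<in> corner p k \<Longrightarrow> x * e = x"
    using internal_unit[OF internal_if_card_3[OF I3 ijk(3)] ijk(3)] by metis
  have "?f a * e = ?f a" "a * e = a" "?g (a * t) * e = ?g (a * t)"
    using e(2) assms(1) ijk by auto
  then show ?thesis using *[OF e(1)] by simp
qed

end

lemma component_d_diagonal:
  assumes a: "a \<in> corner i j" and ijk: "i \<in> I" "j \<in> I" "k \<in> I" "i \<noteq> j" "k \<noteq> i" "k \<noteq> j"
  shows "component k k (d a) = 0"
proof -
  \<comment> \<open>with three indices there is no choice but \<open>r = k\<close>; otherwise \<open>r\<close> also avoids \<open>k\<close>\<close>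
  obtain r where r: "r \<in> I" "r \<noteq> i" "r \<noteq> j" and rk: "card I = 3 \<Longrightarrow> r = k" "card I \<noteq> 3 \<Longrightarrow> r \<noteq> k"
    using index_other_than_3 ijk by metis
  from a show ?thesis
  proof (induction a rule: corner_induct[where r = r])
    case (diff x y)
    then show ?case using d_corner_diff[of i j x y] ijk by (simp add: component_diff)
  next
    case (mult x y)
    show ?case
    proof (cases "card I = 3")
      case True
      then show ?thesis using defect_zero_on_products[of i j k x y] mult rk ijk by auto
    next
      case False
      then show ?thesis using component_d_product[of x i r y j k k] mult rk r ijk by auto
    qed
  qed (use ijk r in auto)
qed

section \<open>Splitting off an inner derivation\<close>

text \<open>
For \<open>p \<noteq> i\<close>, the part of \<open>d\<close> that leads from row \<open>i\<close> to row \<open>p\<close> is right linear, which makes it a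
left multiplication by an element \<open>u \<in> A\<^sub>p\<^sub>i\<close>. There is a mirror image for columns, and
\<open>component_d_cross\<close> couples the two, so that the same \<open>u\<close> serves for both.
\<close>
lemma component_d_mult_right:
  assumes "a \<in> corner i j" "x \<in> corner j k" "i \<in> I" "j \<in> I" "k \<in> I" "p \<in> I" "i \<noteq> j" "j \<noteq> k" "i \<noteq> k" "p \<noteq> i"
  shows "component p k (d (a * x)) = component p j (d a) * x"
  using component_d_product[of a i j x k p k] component_d_diagonal[of a i j k] assms by auto

lemma component_d_mult_left:
  assumes "x \<in> corner j k" "a \<in> corner k p" "j \<in> I" "k \<in> I" "p \<in> I" "i \<in> I" "j \<noteq> k" "k \<noteq> p" "j \<noteq> p" "i \<noteq> p"
  shows "component j i (d (x * a)) = x * component k i (d a)"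
  using component_d_product[of x j k a p j i] component_d_diagonal[of a k p j] assms by auto

lemma component_d_cross:
  assumes "a \<in> corner i j" "b \<in> corner k p" "i \<in> I" "j \<in> I" "k \<in> I" "p \<in> I"
    "i \<noteq> j" "k \<noteq> p" "p \<noteq> i" "j \<noteq> k" "k \<noteq> i \<or> p \<noteq> j"
  shows "component k i (d b) * a = - (b * component p j (d a))"
  using component_d_commuting[of a i j b k p k j] component_d_diagonal[of a i j k] component_d_diagonal[of b k p j] assms
  by (auto split: if_splits)

text \<open>
If \<open>e\<^sub>i \<in> A\<close>, the case \<open>s = e\<^sub>i\<close> is the claim about rows that is wanted. A general \<open>s\<close> is allowed
because \<open>e\<^sub>i\<close> is only a sum of products \<open>xy\<close> with \<open>x \<in> A\<^sub>i\<^sub>j\<close> and \<open>y \<in> A\<^sub>j\<^sub>i\<close>: the set of good \<open>s\<close> is closed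
under differences, and for \<open>s = xy\<close> right linearity exhibits the multiplier as the component
\<open>(p, j)\<close> of \<open>d x\<close>, times \<open>y\<close>.
\<close>
lemma left_multiplier_on_row:
  assumes pi: "p \<in> I" "i \<in> I" "p \<noteq> i" and s: "s \<in> corner i i"
  shows "\<exists>v\<in>corner p i. \<forall>k\<in>I. k \<noteq> i \<longrightarrow> (\<forall>a\<in>corner i k. component p k (d (s * a)) = v * a)"
proof -
  obtain j where j: "j \<in> I" "j \<noteq> i" using index_other_than_2 by metis
  from s show ?thesis
  proof (induction s rule: corner_induct[where r = j])
    case (diff x y)
    then obtain v w where vw: "v \<in> corner p i" "w \<in> corner p i"
      "\<And>k a. k \<in> I \<Longrightarrow> k \<noteq> i \<Longrightarrow> a \<in> corner i k \<Longrightarrow> component p k (d (x * a)) = v * a"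
      "\<And>k a. k \<in> I \<Longrightarrow> k \<noteq> i \<Longrightarrow> a \<in> corner i k \<Longrightarrow> component p k (d (y * a)) = w * a"
      by metis
    have "component p k (d ((x - y) * a)) = (v - w) * a" if "k \<in> I" "k \<noteq> i" "a \<in> corner i k" for k a
    proof -
      have "d ((x - y) * a) = d (x * a) - d (y * a)"
        using d_corner_diff[of i k "x * a" "y * a"] that diff pi corner_mult
        by (simp add: left_diff_distrib)
      then show ?thesis using vw that by (simp add: component_diff left_diff_distrib)
    qed
    then show ?case using vw by blast
  next
    case (mult x y)
    have off: "component p k (d (x * y * a)) = component p j (d x) * y * a"
      if "k \<in> I" "k \<noteq> i" "k \<noteq> j" "a \<in> corner i k" for k a
      using component_d_mult_right[OF mult(1) corner_mult[OF mult(2) that(4)]] that j pi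
      by (simp add: mult.assoc)
    \<comment> \<open>here \<open>ya\<close> is diagonal, so \<open>a\<close> is first factored through a third index \<open>m\<close>\<close>
    have on: "component p j (d (x * y * a)) = component p j (d x) * y * a" if "a \<in> corner i j" for a
    proof -
      obtain m where m: "m \<in> I" "m \<noteq> i" "m \<noteq> j" using index_other_than_2 by metis
      from that show ?thesis
      proof (induction a rule: corner_induct[where r = m])
        case (diff a b)
        have "d (x * y * (a - b)) = d (x * y * a) - d (x * y * b)"
          using d_corner_diff[of i j "x * y * a" "x * y * b"] corner_mult[OF corner_mult[OF mult]] diff(1,2) pi j
          by (simp add: right_diff_distrib)
        then show ?case using diff(3,4) by (simp add: component_diff right_diff_distrib)
      next
        case (mult a c)
        have "x * y * a \<in> corner i m" using corner_mult[OF corner_mult[OF \<open>x \<in> _\<close> \<open>y \<in> _\<close>] mult(1)] .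
        then show ?case
          using component_d_mult_right[of "x * y * a" i m c j p] off[OF _ _ _ mult(1)] mult m j pi
          by (simp add: mult.assoc)
      qed (use pi j m in auto)
    qed
    have "component p j (d x) * y \<in> corner p i" using mult pi j by auto
    then show ?case using on off by metis
  next
    case zero
    show ?case by (rule bexI[of _ 0]) auto
  qed (use pi j in auto)
qed

lemma right_multiplier_on_column:
  assumes pi: "p \<in> I" "i \<in> I" "p \<noteq> i" and s: "s \<in> corner p p"
  shows "\<exists>v\<in>corner p i. \<forall>k\<in>I. k \<noteq> p \<longrightarrow> (\<forall>b\<in>corner k p. component k i (d (b * s)) = b * v)"
proof -
  obtain j where j: "j \<in> I" "j \<noteq> p" using index_other_than_2 by metis
  from s show ?thesis
  proof (induction s rule: corner_induct[where r = j])
    case (diff x y)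
    then obtain v w where vw: "v \<in> corner p i" "w \<in> corner p i"
      "\<And>k b. k \<in> I \<Longrightarrow> k \<noteq> p \<Longrightarrow> b \<in> corner k p \<Longrightarrow> component k i (d (b * x)) = b * v"
      "\<And>k b. k \<in> I \<Longrightarrow> k \<noteq> p \<Longrightarrow> b \<in> corner k p \<Longrightarrow> component k i (d (b * y)) = b * w"
      by metis
    have "component k i (d (b * (x - y))) = b * (v - w)" if "k \<in> I" "k \<noteq> p" "b \<in> corner k p" for k b
    proof -
      have "d (b * (x - y)) = d (b * x) - d (b * y)"
        using d_corner_diff[of k p "b * x" "b * y"] that diff pi corner_mult
        by (simp add: right_diff_distrib)
      then show ?thesis using vw that by (simp add: component_diff right_diff_distrib)
    qed
    then show ?case using vw by blast
  next
    case (mult x y)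
    have off: "component k i (d (b * (x * y))) = b * (x * component j i (d y))"
      if "k \<in> I" "k \<noteq> p" "k \<noteq> j" "b \<in> corner k p" for k b
      using component_d_mult_left[OF corner_mult[OF that(4) mult(1)] mult(2)] that j pi
      by (simp add: mult.assoc)
    have on: "component j i (d (b * (x * y))) = b * (x * component j i (d y))" if "b \<in> corner j p" for b
    proof -
      obtain m where m: "m \<in> I" "m \<noteq> p" "m \<noteq> j" using index_other_than_2 by metis
      from that show ?thesis
      proof (induction b rule: corner_induct[where r = m])
        case (diff a b)
        have "d ((a - b) * (x * y)) = d (a * (x * y)) - d (b * (x * y))"
          using d_corner_diff[of j p "a * (x * y)" "b * (x * y)"] corner_mult[OF _ corner_mult[OF mult]] diff(1,2) pi j
          by (simp add: left_diff_distrib)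
        then show ?case using diff(3,4) by (simp add: component_diff left_diff_distrib)
      next
        case (mult c b)
        have "b * (x * y) \<in> corner m p" using corner_mult[OF mult(2) corner_mult[OF \<open>x \<in> _\<close> \<open>y \<in> _\<close>]] .
        then show ?case
          using component_d_mult_left[of c j m "b * (x * y)" p i] off[OF _ _ _ mult(2)] mult m j pi
          by (simp add: mult.assoc)
      qed (use pi j m in auto)
    qed
    have "x * component j i (d y) \<in> corner p i" using mult pi j by auto
    then show ?case using on off by metis
  next
    case zero
    show ?case by (rule bexI[of _ 0]) auto
  qed (use pi j in auto)
qed

text \<open>
\<open>p \<noteq> i\<close>, so \<open>e\<^sub>p\<close> or \<open>e\<^sub>i\<close> lies in \<open>A\<close>. The element \<open>u\<close> is obtained from rows or from columns
accordingly; the other half follows from \<open>component_d_cross\<close> after cancellation of a factor at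
the internal idempotent. It plays the role of the corner component of \<open>\<Sum>\<^sub>j D(e\<^sub>j)e\<^sub>j\<close>, which cannot be
formed because \<open>d\<close> need not be defined at the \<open>e\<^sub>j\<close>.
\<close>
lemma off_diagonal_part_inner:
  assumes pi: "p \<in> I" "i \<in> I" "p \<noteq> i"
  shows "\<exists>u\<in>corner p i. (\<forall>j\<in>I. j \<noteq> i \<longrightarrow> (\<forall>a\<in>corner i j. component p j (d a) = u * a)) \<and>
    (\<forall>k\<in>I. k \<noteq> p \<longrightarrow> (\<forall>b\<in>corner k p. component k i (d b) = - (b * u)))"
proof -
  consider "internal i" | "internal p" using internal_or pi by metis
  then show ?thesis
  proof cases
    case 1
    obtain e where e: "e \<in> corner i i" "\<And>q x. x \<in> corner i q \<Longrightarrow> e * x = x"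
      using internal_unit[OF 1 pi(2)] by metis
    obtain u where u: "u \<in> corner p i" "\<And>j a. j \<in> I \<Longrightarrow> j \<noteq> i \<Longrightarrow> a \<in> corner i j \<Longrightarrow> component p j (d (e * a)) = u * a"
      using left_multiplier_on_row[OF pi e(1)] by metis
    then have row: "component p j (d a) = u * a" if "j \<in> I" "j \<noteq> i" "a \<in> corner i j" for j a
      using that e(2)[OF that(3)] by metis
    have "component k i (d b) = - (b * u)" if k: "k \<in> I" "k \<noteq> p" "b \<in> corner k p" for k b
    proof -
      obtain j where j: "j \<in> I" "j \<noteq> i" "j \<noteq> k" "k \<noteq> i \<or> p \<noteq> j"
        using index_other_than_2[of i k] index_other_than_2[of i p] by metis
      have "(component k i (d b) + b * u) * a = 0" if a: "a \<in> corner i j" for a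
        using component_d_cross[OF a k(3)] row[OF j(1,2) a] k j pi by (simp add: algebra_simps)
      moreover have "component k i (d b) + b * u \<in> corner k i" using u(1) k pi by auto
      ultimately have "component k i (d b) + b * u = 0"
        using corner_eq_0_right[OF _ 1 pi(2) j(1)] by metis
      then show ?thesis by (simp add: eq_neg_iff_add_eq_0)
    qed
    then show ?thesis using u(1) row by blast
  next
    case 2
    obtain e where e: "e \<in> corner p p" "\<And>q x. x \<in> corner q p \<Longrightarrow> x * e = x"
      using internal_unit[OF 2 pi(1)] by metis
    obtain v where v: "v \<in> corner p i" "\<And>k b. k \<in> I \<Longrightarrow> k \<noteq> p \<Longrightarrow> b \<in> corner k p \<Longrightarrow> component k i (d (b * e)) = b * v"
      using right_multiplier_on_column[OF pi e(1)] by metis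
    then have col: "component k i (d b) = b * v" if "k \<in> I" "k \<noteq> p" "b \<in> corner k p" for k b
      using that e(2)[OF that(3)] by metis
    have "component p j (d a) = - v * a" if j: "j \<in> I" "j \<noteq> i" "a \<in> corner i j" for j a
    proof -
      obtain k where k: "k \<in> I" "k \<noteq> p" "j \<noteq> k" "k \<noteq> i \<or> p \<noteq> j"
        using index_other_than_2[of p j] index_other_than_2[of i p] by metis
      have "b * (component p j (d a) + v * a) = 0" if b: "b \<in> corner k p" for b
        using component_d_cross[OF j(3) b] col[OF k(1,2) b] k j pi by (simp add: algebra_simps)
      moreover have "component p j (d a) + v * a \<in> corner p j" using v(1) j pi by auto
      ultimately have "component p j (d a) + v * a = 0"
        using corner_eq_0_left[OF _ 2 pi(1) k(1)] by metis
      then show ?thesis by (simp add: eq_neg_iff_add_eq_0)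
    qed
    moreover have "- v \<in> corner p i" using v(1) by auto
    ultimately show ?thesis using col by (intro bexI[of _ "- v"]) auto
  qed
qed

text \<open>
Let \<open>u\<close> be the sum of the elements found for all pairs \<open>p \<noteq> i\<close>. Its diagonal components are zero,
hence \<open>[u, a]\<close> accounts exactly for those components of \<open>d a\<close> in row \<open>i\<close> and column \<open>j\<close> that lie
outside the corner \<open>(i, j)\<close>; all others are zero already.
\<close>
lemma inner_up_to_graded:
  "\<exists>u. \<forall>i\<in>I. \<forall>j\<in>I. i \<noteq> j \<longrightarrow> (\<forall>a\<in>corner i j. d a - (u * a - a * u) \<in> corner i j)"
proof -
  define good where "good p i u \<longleftrightarrow> u \<in> corner p i \<and> (\<forall>j\<in>I. j \<noteq> i \<longrightarrow> (\<forall>a\<in>corner i j. component p j (d a) = u * a)) \<and>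
    (\<forall>k\<in>I. k \<noteq> p \<longrightarrow> (\<forall>b\<in>corner k p. component k i (d b) = - (b * u)))" for p i u
  define U where "U p i = (if p = i then 0 else SOME u. good p i u)" for p i
  have good: "good p i (U p i)" if "p \<in> I" "i \<in> I" "p \<noteq> i" for p i
  proof -
    have "\<exists>u. good p i u" using off_diagonal_part_inner[OF that] by (auto simp: good_def)
    then show ?thesis using that by (simp add: U_def someI_ex)
  qed
  then have UC: "U p i \<in> corner p i" if "p \<in> I" "i \<in> I" for p i
    using that by (cases "p = i") (auto simp: U_def good_def)
  define u where "u = (\<Sum>p\<in>I. \<Sum>i\<in>I. U p i)"
  have Pu: "component p i u = U p i" if "p \<in> I" "i \<in> I" for p i
    unfolding u_def using component_assemble[OF UC that] .
  show ?thesis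
  proof (intro exI ballI impI)
    fix i j a
    assume i: "i \<in> I" "j \<in> I" "i \<noteq> j" and a: "a \<in> corner i j"
    let ?z = "d a - (u * a - a * u)"
    have "?z = component i j ?z"
    proof (rule eq_by_component)
      fix p q
      assume p: "p \<in> I" "q \<in> I"
      have Pz: "component p q ?z = component p q (d a) - ((if q = j then U p i * a else 0) - (if p = i then a * U j q else 0))"
        using i a p by (simp add: component_diff component_mult_corner component_corner_mult Pu)
      have "component p q ?z = 0" if pq: "\<not> (p = i \<and> q = j)"
      proof -
        consider "q = j" "p \<noteq> i" | "p = i" "q \<noteq> j" | "p \<noteq> i" "q \<noteq> j" "p = q"
          | "p \<noteq> i" "q \<noteq> j" "p \<noteq> q" using pq by blast
        then show ?thesis
        proof cases
          case 1
          then show ?thesis using Pz good[of p i] i a p by (simp add: good_def)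
        next
          case 2
          then show ?thesis using Pz good[of j q] i a p by (simp add: good_def)
        next
          case 3
          then show ?thesis using Pz component_d_diagonal[OF a] i p by simp
        next
          case 4
          then show ?thesis using Pz component_d_off_diagonal[OF a] i p by simp
        qed
      qed
      then show "component p q ?z = component p q (component i j ?z)"
        using component_of_corner[OF component_in_corner, of i j p q] i p by auto
    qed
    then show "?z \<in> corner i j" using component_in_corner i by metis
  qed
qed

end

section \<open>Extension of a graded Lie derivation\<close>

locale graded_lie_derivation = peirce_lie_derivation I L R d
  for I :: "'i set" and L R :: "'i \<Rightarrow> 'a::ring \<Rightarrow> 'a" and d +
  assumes graded: "i \<in> I \<Longrightarrow> j \<in> I \<Longrightarrow> i \<noteq> j \<Longrightarrow> a \<in> corner i j \<Longrightarrow> d a \<in> corner i j"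
begin

lemma d_mult:
  assumes "a \<in> corner i j" "b \<in> corner j k" "i \<in> I" "j \<in> I" "k \<in> I" "i \<noteq> j" "j \<noteq> k" "i \<noteq> k"
  shows "d (a * b) = d a * b + a * d b"
proof -
  have "b * a = 0" "b * d a = 0" "d b * a = 0"
    using corner_mult_eq_0[of b j k] corner_mult_eq_0[of "d b" j k] graded[of i j a] graded[of j k b] assms
    by auto
  then show ?thesis
    using d_bracket[of a b] off_diagonal_in_commutator_subgroup[of a i j]
      off_diagonal_in_commutator_subgroup[of b j k] assms by simp
qed

text \<open>
\<open>v\<close> is what the value at \<open>s\<close> of a derivation extending \<open>d\<close> has to be, to judge from the products of
\<open>s\<close> with off-diagonal elements. Only products that are again off-diagonal are tested, since
\<open>d\<close> is known there. Off the diagonal this forces \<open>v = d s\<close>; on the diagonal it defines \<open>v\<close>, which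
works also if the idempotent is missing from \<open>A\<close>.
\<close>
definition corner_lift :: "'a \<Rightarrow> 'a \<Rightarrow> 'i \<Rightarrow> 'i \<Rightarrow> bool" where
  "corner_lift s v i j \<longleftrightarrow> s \<in> corner i j \<and> v \<in> corner i j \<and>
    (\<forall>k\<in>I. k \<noteq> i \<longrightarrow> k \<noteq> j \<longrightarrow>
      (\<forall>a\<in>corner j k. d (s * a) = v * a + s * d a) \<and>
      (\<forall>b\<in>corner k i. d (b * s) = d b * s + b * v))"

lemma corner_lift_zero: "corner_lift 0 0 i j"
  by (simp add: corner_lift_def)

lemma corner_lift_diff:
  assumes "corner_lift s v i j" "corner_lift t w i j" "i \<in> I" "j \<in> I"
  shows "corner_lift (s - t) (v - w) i j"
  unfolding corner_lift_def
proof (intro conjI ballI impI)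
  fix k assume k: "k \<in> I" "k \<noteq> i" "k \<noteq> j"
  have st: "s \<in> corner i j" "t \<in> corner i j" using assms by (auto simp: corner_lift_def)
  { fix a assume a: "a \<in> corner j k"
    have "d ((s - t) * a) = d (s * a) - d (t * a)"
      using d_corner_diff[OF assms(3) k(1) k(2)[symmetric] corner_mult[OF st(1) a] corner_mult[OF st(2) a]]
      by (simp add: left_diff_distrib)
    then show "d ((s - t) * a) = (v - w) * a + (s - t) * d a"
      using assms a k by (simp add: corner_lift_def algebra_simps) }
  { fix b assume b: "b \<in> corner k i"
    have "d (b * (s - t)) = d (b * s) - d (b * t)"
      using d_corner_diff[OF k(1) assms(4) k(3) corner_mult[OF b st(1)] corner_mult[OF b st(2)]]
      by (simp add: right_diff_distrib)
    then show "d (b * (s - t)) = d b * (s - t) + b * (v - w)"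
      using assms b k by (simp add: corner_lift_def algebra_simps) }
qed (use assms in \<open>auto simp: corner_lift_def\<close>)

lemma corner_lift_add:
  assumes "corner_lift s v i j" "corner_lift t w i j" "i \<in> I" "j \<in> I"
  shows "corner_lift (s + t) (v + w) i j"
  using corner_lift_diff[OF assms(1) corner_lift_diff[OF corner_lift_zero assms(2-4)] assms(3,4)]
  by simp

lemma corner_lift_sum:
  assumes "\<And>m. m \<in> A \<Longrightarrow> corner_lift (f m) (g m) i j" "i \<in> I" "j \<in> I"
  shows "corner_lift (sum f A) (sum g A) i j"
  using assms(1)
  by (induction A rule: infinite_finite_induct)
    (auto simp: corner_lift_zero intro!: corner_lift_add assms(2,3))

text \<open>
A difference of two candidates is annihilated on the right by \<open>A\<^sub>j\<^sub>k\<close> and on the left by \<open>A\<^sub>k\<^sub>i\<close>.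
\<close>
lemma corner_lift_unique:
  assumes "corner_lift s v i j" "corner_lift s w i j" "i \<in> I" "j \<in> I"
  shows "v = w"
proof -
  obtain k where k: "k \<in> I" "k \<noteq> i" "k \<noteq> j" using index_other_than_2 by metis
  have z: "corner_lift 0 (v - w) i j" using corner_lift_diff[OF assms] by simp
  then have "v - w = 0"
    by (intro corner_eq_0[of "v - w" i j k k]) (use z k assms(3,4) in \<open>auto simp: corner_lift_def\<close>)
  then show ?thesis by simp
qed

lemma corner_lift_off_diagonal:
  assumes "s \<in> corner i j" "i \<in> I" "j \<in> I" "i \<noteq> j"
  shows "corner_lift s (d s) i j"
  unfolding corner_lift_def
  using d_mult[OF assms(1)] d_mult[OF _ assms(1)] graded assms by auto

text \<open>
Associativity does the work: \<open>d((st)a) = d(s(ta))\<close> can be expanded whenever \<open>s\<close> may be tested on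
\<open>ta\<close> and \<open>t\<close> on \<open>a\<close>. The exception, up to reflection, is \<open>a \<in> A\<^sub>l\<^sub>j\<close>, where \<open>ta\<close> is diagonal. If \<open>i \<noteq> l\<close>, then
\<open>st\<close> is off-diagonal and it is enough to compute \<open>d(st)\<close>; if \<open>i = l\<close>, then \<open>a\<close> is factored through an index
different from \<open>i\<close> and \<open>j\<close>.
\<close>
lemma corner_lift_mult:
  assumes s: "corner_lift s v i j" and t: "corner_lift t w j l" and I: "i \<in> I" "j \<in> I" "l \<in> I"
  shows "corner_lift (s * t) (v * t + s * w) i l"
proof -
  have mem: "s \<in> corner i j" "v \<in> corner i j" "t \<in> corner j l" "w \<in> corner j l"
    using s t by (auto simp: corner_lift_def)
  have v: "v = d s" if "i \<noteq> j"
    using corner_lift_unique[OF s corner_lift_off_diagonal] mem I that by auto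
  have w: "w = d t" if "j \<noteq> l"
    using corner_lift_unique[OF t corner_lift_off_diagonal] mem I that by auto
  show ?thesis
  proof (cases "i = l")
    case False
    have "d (s * t) = v * t + s * w"
    proof -
      consider "i \<noteq> j" "j \<noteq> l" | "i = j" | "j = l" by blast
      then show ?thesis
      proof cases
        case 1
        then show ?thesis using d_mult[OF mem(1,3) I] False v w by simp
      next
        case 2
        then show ?thesis using s t mem I w False by (simp add: corner_lift_def)
      next
        case 3
        then show ?thesis using s t mem I v False by (simp add: corner_lift_def)
      qed
    qed
    then show ?thesis
      using corner_lift_off_diagonal[OF corner_mult[OF mem(1,3)]] I False by simp
  next
    case True
    have st: "s * t \<in> corner i i" using mem True by auto
    have right: "d (s * t * a) = (v * t + s * w) * a + s * t * d a"
      if k: "k \<in> I" "k \<noteq> i" "k \<noteq> j" "a \<in> corner l k" for k a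
    proof -
      have "d (s * (t * a)) = v * (t * a) + s * d (t * a)"
        using s k corner_mult[OF mem(3) k(4)] by (auto simp: corner_lift_def)
      moreover have "d (t * a) = w * a + t * d a"
        using t k True by (auto simp: corner_lift_def)
      ultimately show ?thesis by (simp add: algebra_simps)
    qed
    have left: "d (b * (s * t)) = d b * (s * t) + b * (v * t + s * w)"
      if k: "k \<in> I" "k \<noteq> i" "k \<noteq> j" "b \<in> corner k i" for k b
    proof -
      have "d (b * s * t) = d (b * s) * t + b * s * w"
        using t k True corner_mult[OF k(4) mem(1)] by (auto simp: corner_lift_def)
      moreover have "d (b * s) = d b * s + b * v"
        using s k by (auto simp: corner_lift_def)
      ultimately show ?thesis by (simp add: algebra_simps)
    qed
    obtain m where m: "m \<in> I" "m \<noteq> i" "m \<noteq> j" using index_other_than_2 by metis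
    have right': "d (s * t * a) = (v * t + s * w) * a + s * t * d a"
      if a: "a \<in> corner l j" and ij: "i \<noteq> j" for a
      using a
    proof (induction a rule: corner_induct[where r = m])
      case (diff x y)
      have "d (s * t * (x - y)) = d (s * t * x) - d (s * t * y)"
        using d_corner_diff[OF I(1,2) ij, of "s * t * x" "s * t * y"] corner_mult[OF st] diff(1,2) True
        by (simp add: right_diff_distrib)
      moreover have "d (x - y) = d x - d y"
        using d_corner_diff[OF I(1,2) ij] diff(1,2) True by simp
      ultimately show ?case using diff(3,4) by (simp add: right_diff_distrib)
    next
      case (mult x y)
      have x: "x \<in> corner i m" and stx: "s * t * x \<in> corner i m" using mult corner_mult[OF st] True by auto
      have "d (s * t * x * y) = d (s * t * x) * y + s * t * x * d y"
        using d_mult[OF stx mult(2)] I m ij by auto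
      moreover have "d (x * y) = d x * y + x * d y"
        using d_mult[OF x mult(2)] I m ij by auto
      moreover have "d (s * t * x) = (v * t + s * w) * x + s * t * d x"
        using right[OF m mult(1)] .
      ultimately show ?case by (simp add: distrib_left distrib_right mult.assoc)
    qed (use I m in auto)
    have left': "d (b * (s * t)) = d b * (s * t) + b * (v * t + s * w)"
      if b: "b \<in> corner j i" and ij: "i \<noteq> j" for b
      using b
    proof (induction b rule: corner_induct[where r = m])
      case (diff x y)
      have "d ((x - y) * (s * t)) = d (x * (s * t)) - d (y * (s * t))"
        using d_corner_diff[OF I(2,1) ij[symmetric], of "x * (s * t)" "y * (s * t)"] corner_mult[OF _ st] diff(1,2)
        by (simp add: left_diff_distrib)
      moreover have "d (x - y) = d x - d y"
        using d_corner_diff[OF I(2,1) ij[symmetric]] diff(1,2) by simp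
      ultimately show ?case using diff(3,4) by (simp add: left_diff_distrib)
    next
      case (mult y x)
      have xst: "x * (s * t) \<in> corner m i" using mult corner_mult[OF _ st] by auto
      have "d (y * (x * (s * t))) = d y * (x * (s * t)) + y * d (x * (s * t))"
        using d_mult[OF mult(1) xst] I m ij by auto
      moreover have "d (y * x) = d y * x + y * d x"
        using d_mult[OF mult(1,2)] I m ij by auto
      moreover have "d (x * (s * t)) = d x * (s * t) + x * (v * t + s * w)"
        using left[OF m mult(2)] .
      ultimately show ?case by (simp add: distrib_left distrib_right mult.assoc)
    qed (use I m in auto)
    have "v * t + s * w \<in> corner i l" using mem by auto
    then show ?thesis
      unfolding corner_lift_def using st True right right' left left' by metis
  qed
qed

text \<open>
On the diagonal, \<open>A\<^sub>i\<^sub>i = A\<^sub>i\<^sub>kA\<^sub>k\<^sub>i\<close>, and for \<open>x \<in> A\<^sub>i\<^sub>k\<close>, \<open>y \<in> A\<^sub>k\<^sub>i\<close> the value at \<open>xy\<close> is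
\<open>d(x)y + xd(y)\<close>. That this does not depend on the representation as a sum of products is the
uniqueness just proved.
\<close>
lemma corner_lift_exists:
  assumes "s \<in> corner i j" "i \<in> I" "j \<in> I"
  shows "\<exists>v. corner_lift s v i j"
proof (cases "i = j")
  case False
  then show ?thesis using corner_lift_off_diagonal assms by blast
next
  case True
  obtain k where k: "k \<in> I" "k \<noteq> i" using index_other_than_2 by metis
  from assms(1) show ?thesis
  proof (induction s rule: corner_induct[where r = k])
    case zero
    show ?case using corner_lift_zero by blast
  next
    case (diff x y)
    then show ?case using corner_lift_diff assms(2,3) by blast
  next
    case (mult x y)
    then show ?case
      using corner_lift_mult[OF corner_lift_off_diagonal corner_lift_off_diagonal] k assms(2,3) True
      by metis
  qed (use k assms in auto)
qed

text \<open>
The graph of the extension. As a relation it is closed under sums and products, so the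
derivation property needs no further computation once it is shown to be a function.
\<close>
definition lift :: "'a \<Rightarrow> 'a \<Rightarrow> bool" where
  "lift x v \<longleftrightarrow> (\<forall>i\<in>I. \<forall>j\<in>I. corner_lift (component i j x) (component i j v) i j)"

lemma lift_unique: "lift x v \<Longrightarrow> lift x w \<Longrightarrow> v = w"
  by (rule eq_by_component) (unfold lift_def, blast intro: corner_lift_unique)

lemma lift_exists: "\<exists>v. lift x v"
proof -
  define f where "f i j = (SOME v. corner_lift (component i j x) v i j)" for i j
  have f: "corner_lift (component i j x) (f i j) i j" if "i \<in> I" "j \<in> I" for i j
    unfolding f_def using corner_lift_exists[OF component_in_corner] that by (auto intro: someI_ex)
  then have "component i j (\<Sum>p\<in>I. \<Sum>q\<in>I. f p q) = f i j" if "i \<in> I" "j \<in> I" for i j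
    using that by (intro component_assemble) (auto simp: corner_lift_def)
  then have "lift x (\<Sum>p\<in>I. \<Sum>q\<in>I. f p q)" using f by (simp add: lift_def)
  then show ?thesis ..
qed

lemma lift_diff: "lift x v \<Longrightarrow> lift y w \<Longrightarrow> lift (x - y) (v - w)"
  by (auto simp: lift_def component_diff intro: corner_lift_diff)

lemma lift_add: "lift x v \<Longrightarrow> lift y w \<Longrightarrow> lift (x + y) (v + w)"
  by (auto simp: lift_def component_add intro: corner_lift_add)

lemma lift_mult: "lift x v \<Longrightarrow> lift y w \<Longrightarrow> lift (x * y) (v * y + x * w)"
  unfolding lift_def
  by (auto simp: component_add component_mult simp flip: sum.distrib intro!: corner_lift_sum corner_lift_mult)

lemma lift_off_diagonal:
  assumes "i \<in> I" "j \<in> I" "i \<noteq> j" "x \<in> corner i j"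
  shows "lift x (d x)"
  unfolding lift_def
proof (intro ballI)
  fix p q assume "p \<in> I" "q \<in> I"
  then show "corner_lift (component p q x) (component p q (d x)) p q"
    using assms graded[OF assms] corner_lift_off_diagonal[of x i j] corner_lift_zero
    by (simp add: component_of_corner)
qed

lemma lift_commutator:
  assumes "x \<in> commutator_subgroup"
  shows "lift x (d x)"
  using assms
proof (induction x rule: commutator_subgroup_induct)
  case zero
  show ?case by (simp add: lift_def corner_lift_zero)
next
  case (diff x y)
  then show ?case using lift_diff by (simp add: d_diff)
next
  case (corner i j x)
  then show ?case by (rule lift_off_diagonal)
next
  case (bracket i j x y)
  have "lift x (d x)" "lift y (d y)" using bracket lift_off_diagonal by metis+
  then have "lift (x * y - y * x) ((d x * y + x * d y) - (d y * x + y * d x))"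
    by (intro lift_diff lift_mult)
  moreover have "d (x * y - y * x) = (d x * y + x * d y) - (d y * x + y * d x)"
    using d_bracket[of x y] bracket off_diagonal_in_commutator_subgroup[of x i j]
      off_diagonal_in_commutator_subgroup[of y j i] by (simp add: algebra_simps)
  ultimately show ?case by (simp add: lie_bracket_def)
qed

lemma extends_to_derivation_if_graded:
  "\<exists>D. ring_derivation D \<and> (\<forall>x\<in>commutator_subgroup. D x = d x)"
proof -
  obtain D where D: "\<And>x. lift x (D x)" using lift_exists by metis
  have "D (x + y) = D x + D y" for x y
    using lift_unique D lift_add by metis
  moreover have "D (x * y) = D x * y + x * D y" for x y
    using lift_unique D lift_mult by metis
  moreover have "D x = d x" if "x \<in> commutator_subgroup" for x
    using lift_unique D lift_commutator[OF that] by metis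
  ultimately show ?thesis
    by (intro exI[of _ D]) (simp add: ring_derivation_def additive_def)
qed

end

section \<open>Extension of an arbitrary Lie derivation\<close>

lemma lie_derivation_minus_inner:
  fixes u :: "'a::ring"
  assumes "lie_derivation_commutators d"
  shows "lie_derivation_commutators (\<lambda>x. d x - (u * x - x * u))"
  unfolding lie_derivation_commutators_def
proof (intro conjI ballI subsetI)
  have inn: "u * x - x * u \<in> commutator_subgroup" for x
    using lie_bracket_in_commutator_subgroup[of u x] by (simp add: lie_bracket_def)
  fix y assume "y \<in> (\<lambda>x. d x - (u * x - x * u)) ` commutator_subgroup"
  then obtain x where x: "x \<in> commutator_subgroup" "y = d x - (u * x - x * u)" by auto
  then have "d x \<in> commutator_subgroup"
    using assms by (auto simp: lie_derivation_commutators_def)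
  then show "y \<in> commutator_subgroup"
    using x(2) inn[of x] by (simp add: commutator_subgroup_def group_closure.diff)
next
  fix x y :: 'a assume xy: "x \<in> commutator_subgroup" "y \<in> commutator_subgroup"
  show "d (x + y) - (u * (x + y) - (x + y) * u) =
      d x - (u * x - x * u) + (d y - (u * y - y * u))"
    using assms xy by (simp add: lie_derivation_commutators_def algebra_simps)
  have "d (lie_bracket x y) = lie_bracket (d x) y + lie_bracket x (d y)"
    using assms xy by (simp add: lie_derivation_commutators_def)
  then show "d (lie_bracket x y) - (u * lie_bracket x y - lie_bracket x y * u) =
      lie_bracket (d x - (u * x - x * u)) y + lie_bracket x (d y - (u * y - y * u))"
    by (simp add: lie_bracket_def) (simp add: algebra_simps)
qed

lemma ring_derivation_plus_inner:
  fixes u :: "'a::ring"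
  assumes "ring_derivation D"
  shows "ring_derivation (\<lambda>x. D x + (u * x - x * u))"
  using assms by (simp add: ring_derivation_def additive_def algebra_simps)

theorem (in peirce_lie_derivation) extends_to_ring_derivation:
  "\<exists>D. ring_derivation D \<and> (\<forall>x\<in>commutator_subgroup. D x = d x)"
proof -
  obtain u where u: "\<And>i j a. i \<in> I \<Longrightarrow> j \<in> I \<Longrightarrow> i \<noteq> j \<Longrightarrow> a \<in> corner i j \<Longrightarrow>
      d a - (u * a - a * u) \<in> corner i j"
    using inner_up_to_graded by metis
  interpret graded: graded_lie_derivation I L R "\<lambda>x. d x - (u * x - x * u)"
    by unfold_locales (simp_all add: lie_derivation_minus_inner lie u)
  obtain D where D: "ring_derivation D"
    "\<And>x. x \<in> commutator_subgroup \<Longrightarrow> D x = d x - (u * x - x * u)"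
    using graded.extends_to_derivation_if_graded by blast
  show ?thesis
    using ring_derivation_plus_inner[OF D(1), of u] D(2)
    by (intro exI[of _ "\<lambda>x. D x + (u * x - x * u)"]) simp
qed

section \<open>Peirce systems from three idempotents\<close>

text \<open>
The index \<open>3\<close> stands for \<open>e\<^sub>4 = 1 - e\<^sub>1 - e\<^sub>2 - e\<^sub>3\<close>, with \<open>e 0\<close>, \<open>e 1\<close>, \<open>e 2\<close> for \<open>e\<^sub>1\<close>, \<open>e\<^sub>2\<close>, \<open>e\<^sub>3\<close>.
\<close>
definition left_peirce :: "(nat \<Rightarrow> 'a::ring) \<Rightarrow> nat \<Rightarrow> 'a \<Rightarrow> 'a" where
  "left_peirce e i x = (if i < 3 then e i * x else x - (e 0 * x + e 1 * x + e 2 * x))"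

definition right_peirce :: "(nat \<Rightarrow> 'a::ring) \<Rightarrow> nat \<Rightarrow> 'a \<Rightarrow> 'a" where
  "right_peirce e i x = (if i < 3 then x * e i else x - (x * e 0 + x * e 1 + x * e 2))"

lemma peirce_system_of_idempotents:
  fixes e :: "nat \<Rightarrow> 'a::ring"
  assumes orth: "\<And>i j. i < 3 \<Longrightarrow> j < 3 \<Longrightarrow> e i * e j = (if i = j then e i else 0)"
    and full: "\<And>i. i < 3 \<Longrightarrow> two_sided_span (e i) = UNIV"
    and faithful: "\<And>a::'a. (\<And>b. a * b = 0) \<Longrightarrow> (\<And>b. b * a = 0) \<Longrightarrow> a = 0"
    and cases: "n = 3 \<and> is_identity (e 0 + e 1 + e 2) \<or>
      n = 4 \<and> two_sided_span_compl (e 0) (e 1) (e 2) = UNIV"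
  shows "peirce_system {..<n} (left_peirce e) (right_peirce e)"
proof
  have n: "n = 3 \<or> n = 4" using cases by auto
  have orth_left: "e i * (e j * x) = (if i = j then e i * x else 0)" if "i < 3" "j < 3" for i j x
    using orth[OF that] by (auto simp flip: mult.assoc)
  have orth_right: "x * e i * e j = (if i = j then x * e i else 0)" if "i < 3" "j < 3" for i j x
    using orth[OF that] by (simp add: mult.assoc)
  show "finite {..<n}" "3 \<le> card {..<n}" using n by auto
  show "left_peirce e i (x - y) = left_peirce e i x - left_peirce e i y"
    "right_peirce e i (x - y) = right_peirce e i x - right_peirce e i y"
    "left_peirce e i (x * y) = left_peirce e i x * y"
    "right_peirce e i (x * y) = x * right_peirce e i y"
    "right_peirce e i x * y = x * left_peirce e i y"
    "left_peirce e i (right_peirce e j x) = right_peirce e j (left_peirce e i x)"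
    for i j x y by (simp_all add: left_peirce_def right_peirce_def algebra_simps)
  have cases_3: "i = 3" if "i < n" "\<not> i < 3" for i using that n by auto
  have idem: "left_peirce e i (left_peirce e j x) = (if i = j then left_peirce e i x else 0)"
    "right_peirce e i (right_peirce e j x) = (if i = j then right_peirce e i x else 0)"
    if "i < n" "j < n" for i j x
  proof -
    have i: "i = 0 \<or> i = 1 \<or> i = 2 \<or> i = 3" "j = 0 \<or> j = 1 \<or> j = 2 \<or> j = 3"
      using that n by auto
    show "left_peirce e i (left_peirce e j x) = (if i = j then left_peirce e i x else 0)"
      using i by (elim disjE) (simp_all add: left_peirce_def orth_left right_diff_distrib distrib_left)
    show "right_peirce e i (right_peirce e j x) = (if i = j then right_peirce e i x else 0)"
      using i by (elim disjE) (simp_all add: right_peirce_def orth_right left_diff_distrib distrib_right)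
  qed
  show "left_peirce e i (left_peirce e j x) = (if i = j then left_peirce e i x else 0)"
    "right_peirce e i (right_peirce e j x) = (if i = j then right_peirce e i x else 0)"
    if "i \<in> {..<n}" "j \<in> {..<n}" for i j x
    using that idem by auto
  have sums: "(\<Sum>i<3. f i) = f 0 + f 1 + f 2" "(\<Sum>i<4. f i) = f 0 + f 1 + f 2 + f 3"
    for f :: "nat \<Rightarrow> 'a"
    by (simp_all add: eval_nat_numeral)
  show "(\<Sum>i<n. left_peirce e i x) = x" "(\<Sum>i<n. right_peirce e i x) = x" for x
  proof -
    have "n = 3 \<and> (e 0 + e 1 + e 2) * x = x \<and> x * (e 0 + e 1 + e 2) = x \<or> n = 4"
      using cases unfolding is_identity_def by blast
    then show "(\<Sum>i<n. left_peirce e i x) = x" "(\<Sum>i<n. right_peirce e i x) = x"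
      by (elim disjE conjE; simp add: sums left_peirce_def right_peirce_def distrib_left distrib_right)+
  qed
  show "group_closure {right_peirce e i a * b |a b. True} = UNIV" if "i \<in> {..<n}" for i
  proof (cases "i < 3")
    case True
    then show ?thesis using full[OF True] by (simp add: right_peirce_def two_sided_span_def)
  next
    case False
    then have "two_sided_span_compl (e 0) (e 1) (e 2) = UNIV" using that cases by auto
    then show ?thesis
      using False by (simp add: right_peirce_def two_sided_span_compl_def left_diff_distrib distrib_right)
  qed
  have internal: "internal_multiplier (left_peirce e i) (right_peirce e i)" if "i < 3" for i
    using that unfolding internal_multiplier_def left_peirce_def right_peirce_def by auto
  show "internal_multiplier (left_peirce e i) (right_peirce e i) \<or>
      internal_multiplier (left_peirce e j) (right_peirce e j)"
    if "i \<in> {..<n}" "j \<in> {..<n}" "i \<noteq> j" for i j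
    using that internal[of i] internal[of j] cases_3[of i] cases_3[of j] by auto
  show "internal_multiplier (left_peirce e i) (right_peirce e i)"
    if "card {..<n} = 3" "i \<in> {..<n}" for i
    using that internal by auto
qed (rule faithful)

text \<open>
Under condition (I) the idempotent \<open>e\<^sub>4\<close> is zero, hence not full unless \<open>A = (0)\<close>, and is left out; under
condition (II) it is full and provides the fourth index.
\<close>
lemma condition_imp_peirce_system:
  assumes "condition_I TYPE('a::ring) \<or> condition_II TYPE('a)"
  shows "\<exists>I L R. peirce_system (I :: nat set) L (R :: nat \<Rightarrow> 'a \<Rightarrow> 'a)"
proof -
  have main: "\<exists>I L R. peirce_system (I :: nat set) L (R :: nat \<Rightarrow> 'a \<Rightarrow> 'a)"
    if "idempotent_elt e1" "idempotent_elt e2" "idempotent_elt e3" "pairwise_orthogonal3 e1 e2 e3"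
      "two_sided_span e1 = UNIV" "two_sided_span e2 = UNIV" "two_sided_span e3 = UNIV"
      and faithful: "\<And>a::'a. (\<And>b. a * b = 0) \<Longrightarrow> (\<And>b. b * a = 0) \<Longrightarrow> a = 0"
      and compl: "is_identity (e1 + e2 + e3) \<or> two_sided_span_compl e1 e2 e3 = UNIV"
    for e1 e2 e3 :: 'a
  proof -
    define e :: "nat \<Rightarrow> 'a" where "e i = [e1, e2, e3] ! i" for i
    have e: "e 0 = e1" "e 1 = e2" "e 2 = e3" by (simp_all add: e_def)
    have less_3: "i = 0 \<or> i = 1 \<or> i = 2" if "i < 3" for i :: nat using that by auto
    have "e i * e j = (if i = j then e i else 0)" if "i < 3" "j < 3" for i j
      using less_3[OF that(1)] less_3[OF that(2)] \<open>idempotent_elt e1\<close> \<open>idempotent_elt e2\<close>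
        \<open>idempotent_elt e3\<close> \<open>pairwise_orthogonal3 e1 e2 e3\<close>
      by (auto simp: e e[unfolded One_nat_def] idempotent_elt_def pairwise_orthogonal3_def
          orthogonal_elts_def)
    moreover have "two_sided_span (e i) = UNIV" if "i < 3" for i
      using less_3[OF that(1)] \<open>two_sided_span e1 = UNIV\<close> \<open>two_sided_span e2 = UNIV\<close>
        \<open>two_sided_span e3 = UNIV\<close> by (auto simp: e e[unfolded One_nat_def])
    moreover have "\<exists>n::nat. n = 3 \<and> is_identity (e 0 + e 1 + e 2) \<or>
        n = 4 \<and> two_sided_span_compl (e 0) (e 1) (e 2) = UNIV"
      using compl unfolding e by blast
    ultimately show ?thesis
      using peirce_system_of_idempotents[of e] faithful by blast
  qed
  from assms show ?thesis
  proof
    assume "condition_I TYPE('a)"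
    then obtain u e1 e2 e3 :: 'a where *: "is_identity u" "full_idempotent e1" "full_idempotent e2"
      "full_idempotent e3" "pairwise_orthogonal3 e1 e2 e3" "e1 + e2 + e3 = u"
      by (auto simp: condition_I_def)
    show ?thesis
    proof (rule main[of e1 e2 e3])
      show "a = 0" if "\<And>b. a * b = 0" for a :: 'a
        using that[of u] *(1) by (simp add: is_identity_def)
    qed (use * in \<open>auto simp: full_idempotent_def\<close>)
  next
    assume "condition_II TYPE('a)"
    then obtain e1 e2 e3 :: 'a where *: "idempotent_elt e1" "idempotent_elt e2" "idempotent_elt e3"
      "pairwise_orthogonal3 e1 e2 e3" "two_sided_span e1 = UNIV" "two_sided_span e2 = UNIV"
      "two_sided_span e3 = UNIV" "two_sided_span_compl e1 e2 e3 = UNIV"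
      and ann: "(annihilator :: 'a set) = {0}"
      unfolding condition_II_def by blast
    show ?thesis
    proof (rule main[of e1 e2 e3])
      show "a = 0" if "\<And>b. a * b = 0" "\<And>b. b * a = 0" for a :: 'a
      proof -
        have "a \<in> annihilator" using that by (simp add: annihilator_def)
        then show ?thesis using ann by blast
      qed
    qed (use * in auto)
  qed
qed

theorem theorem3:
  fixes d :: "'a::ring \<Rightarrow> 'a"
  assumes "condition_I TYPE('a) \<or> condition_II TYPE('a)"
    and "lie_derivation_commutators d"
  shows "\<exists>D :: 'a \<Rightarrow> 'a. ring_derivation D \<and> (\<forall>x\<in>commutator_subgroup. D x = d x)"
proof -
  obtain I :: "nat set" and L R :: "nat \<Rightarrow> 'a \<Rightarrow> 'a" where "peirce_system I L R"
    using condition_imp_peirce_system assms(1) by blast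
  then interpret peirce_lie_derivation I L R d
    by (simp add: peirce_lie_derivation_def peirce_lie_derivation_axioms_def assms(2))
  show ?thesis by (rule extends_to_ring_derivation)
qed

end
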